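(* The following identities hold in $L(n)$, for $n,\ell\in\mathbb N$: $$F^{(n-2\ell)}\eta=\sum_{c=0}^{\lfloor n/2\rfloor-\ell}(-1)^cq^{-(2\ell+1)c}\begin{bmatrix}\ell+c\\ c\end{bmatrix}_{q^2}B_{\overline n}^{(n-2\ell-2c)}\eta,$$ $$F^{(n-1-2\ell)}\eta=\sum_{c=0}^{\lfloor (n-1)/2\rfloor-\ell}(-1)^cq^{-(2\ell+3)c}\begin{bmatrix}\ell+c\\ c\end{bmatrix}_{q^2}B_{\overline n}^{(n-1-2\ell-2c)}\eta.$$
   Context: $\mathbf U=\mathbf U_q(\mathfrak{sl}_2)$ over (the algebraic closure of) $\mathbb Q(q)$, with generators $E,F,K^{\pm1}$: $KE=q^2EK$, $KF=q^{-2}FK$, $[E,F]=\frac{K-K^{-1}}{q-q^{-1}}$. $[m]=\frac{q^m-q^{-m}}{q-q^{-1}}$, $F^{(m)}=F^m/[m]!$ (zero for $m<0$). $L(n)$ is the simple $\mathbf U$-module of highest weight $n\in\mathbb N$ (i.e. $K\eta=q^n\eta$, $E\eta=0$) with highest weight vector $\eta$. Let $B=F+q^{-1}EK^{-1}$ (parameter $\varsigma=q^{-1}$). The idivided powers are, for $m\ge1$, $$B_{\overline0}^{(m)}=\tfrac1{[m]!}B^{1+\delta_{\overline m,\overline0}}\prod_{r=1}^{\lceil m/2\rceil-1}(B^2-[2r]^2),\qquad B_{\overline1}^{(m)}=\tfrac1{[m]!}B^{\delta_{\overline m,\overline1}}\prod_{r=1}^{\lfloor m/2\rfloor}(B^2-[2r-1]^2),$$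 and $B_{\overline p}^{(0)}=1$; $\overline n$ is the residue of $n$ mod 2. $\begin{bmatrix}m\\ r\end{bmatrix}_{q^2}$ is the (balanced) quantum binomial coefficient $\prod_{s=1}^r\frac{[m-s+1]}{[s]}$ with $q$ replaced by $q^2$. Empty sums are $0$. *)

theory Defs
  imports Complex_Main "HOL-Computational_Algebra.Computational_Algebra"
begin

text \<open>The field of rational functions in one variable over the rationals is \<open>rat poly fract\<close>.\<close>

definition q_var :: "rat poly fract" where
  "q_var = Fract [:0, 1:] 1"

text \<open>
  The ground field is either the field of rational functions itself (first disjunct) or
  an algebraic closure of it (second disjunct).
\<close>

locale ground_field =
  fixes \<iota> :: "rat poly fract \<Rightarrow> 'k::field"
  assumes iota_one: "\<iota> 1 = 1"
    and iota_add: "\<iota> (x + y) = \<iota> x + \<iota> y"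
    and iota_mult: "\<iota> (x * y) = \<iota> x * \<iota> y"
    and surj_or_algebraic_closure:
      "surj \<iota> \<or>
       ((\<forall>a. \<exists>p. p \<noteq> 0 \<and> poly (map_poly \<iota> p) a = 0) \<and>
        (\<forall>p :: 'k poly. degree p > 0 \<longrightarrow> (\<exists>a. poly p a = 0)))"

definition qint :: "'k::field \<Rightarrow> int \<Rightarrow> 'k" where
  "qint q m = (q powi m - q powi (- m)) / (q - inverse q)"

definition qfact :: "'k::field \<Rightarrow> nat \<Rightarrow> 'k" where
  "qfact q m = (\<Prod>s = 1..m. qint q (int s))"

text \<open>The binomial for parameter \<open>q\<^sup>2\<close> is \<open>qbinom (q ^ 2)\<close>.\<close>

definition qbinom :: "'k::field \<Rightarrow> int \<Rightarrow> nat \<Rightarrow> 'k" where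
  "qbinom q m r = (\<Prod>s = 1..r. qint q (m - int s + 1) / qint q (int s))"

text \<open>
  The algebra is given by generators and relations, so a module over it is a vector space with
  linear operators \<open>E\<close>, \<open>F\<close>, \<open>K\<close>, \<open>K'\<close> (the last one for the inverse of \<open>K\<close>)
  that satisfy the defining relations.
\<close>

locale Uq_sl2_module = vector_space scale
  for scale :: "'k::field \<Rightarrow> 'v::ab_group_add \<Rightarrow> 'v" +
  fixes q :: 'k and E F K K' :: "'v \<Rightarrow> 'v"
  assumes linear_E: "Vector_Spaces.linear scale scale E"
    and linear_F: "Vector_Spaces.linear scale scale F"
    and linear_K: "Vector_Spaces.linear scale scale K"
    and linear_K': "Vector_Spaces.linear scale scale K'"
    and K_K': "K (K' v) = v"
    and K'_K: "K' (K v) = v"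
    and K_E: "K (E v) = scale (q powi 2) (E (K v))"
    and K_F: "K (F v) = scale (q powi (-2)) (F (K v))"
    and E_F: "E (F v) - F (E v) = scale (1 / (q - inverse q)) (K v - K' v)"

locale simple_highest_weight_module = Uq_sl2_module scale q E F K K'
  for scale :: "'k::field \<Rightarrow> 'v::ab_group_add \<Rightarrow> 'v"
    and q :: 'k and E F K K' :: "'v \<Rightarrow> 'v" +
  fixes n :: nat and \<eta> :: 'v
  assumes nonzero: "\<exists>v :: 'v. v \<noteq> 0"
    and simple: "\<lbrakk>subspace W; E ` W \<subseteq> W; F ` W \<subseteq> W; K ` W \<subseteq> W; K' ` W \<subseteq> W\<rbrakk>
      \<Longrightarrow> W = {0} \<or> W = UNIV"
    and eta_nonzero: "\<eta> \<noteq> 0"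
    and K_eta: "K \<eta> = scale (q ^ n) \<eta>"
    and E_eta: "E \<eta> = 0"

definition F_div ::
  "('k::field \<Rightarrow> 'v::ab_group_add \<Rightarrow> 'v) \<Rightarrow> 'k \<Rightarrow> ('v \<Rightarrow> 'v) \<Rightarrow> int \<Rightarrow> 'v \<Rightarrow> 'v" where
  "F_div scale q F m v =
     (if m < 0 then 0 else scale (1 / qfact q (nat m)) ((F ^^ nat m) v))"

text \<open>The element \<open>F + \<varsigma> E K\<^sup>-\<^sup>1\<close> for the parameter \<open>\<varsigma> = q\<^sup>-\<^sup>1\<close>.\<close>

definition B_op ::
  "('k::field \<Rightarrow> 'v::ab_group_add \<Rightarrow> 'v) \<Rightarrow> 'k \<Rightarrow> ('v \<Rightarrow> 'v) \<Rightarrow> ('v \<Rightarrow> 'v) \<Rightarrow> ('v \<Rightarrow> 'v) \<Rightarrow> 'v \<Rightarrow> 'v" where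
  "B_op scale q E F K' v = F v + scale (inverse q) (E (K' v))"

definition B_prod ::
  "('k::field \<Rightarrow> 'v::ab_group_add \<Rightarrow> 'v) \<Rightarrow> 'k \<Rightarrow> ('v \<Rightarrow> 'v) \<Rightarrow> nat list \<Rightarrow> 'v \<Rightarrow> 'v" where
  "B_prod scale q B rs =
     foldr (\<circ>) (map (\<lambda>r v. (B ^^ 2) v - scale (qint q (int r) ^ 2) v) rs) id"

text \<open>
  The idivided power with exponent \<open>m\<close> whose parity index is the residue of \<open>p\<close> modulo 2.
  The list \<open>[1..<(m + 1) div 2]\<close> runs from \<open>1\<close> to \<open>\<lceil>m/2\<rceil> - 1\<close>,
  and \<open>[1..<m div 2 + 1]\<close> from \<open>1\<close> to \<open>\<lfloor>m/2\<rfloor>\<close>.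
\<close>

definition B_idiv ::
  "('k::field \<Rightarrow> 'v::ab_group_add \<Rightarrow> 'v) \<Rightarrow> 'k \<Rightarrow> ('v \<Rightarrow> 'v) \<Rightarrow> nat \<Rightarrow> nat \<Rightarrow> 'v \<Rightarrow> 'v" where
  "B_idiv scale q B p m v =
     (if m = 0 then v
      else if even p then
        scale (1 / qfact q m)
          ((B ^^ (1 + of_bool (even m)))
            (B_prod scale q B (map (\<lambda>r. 2 * r) [1..<(m + 1) div 2]) v))
      else
        scale (1 / qfact q m)
          ((B ^^ of_bool (odd m))
            (B_prod scale q B (map (\<lambda>r. 2 * r - 1) [1..<m div 2 + 1]) v)))"

end

theory Submission
  imports Defs
begin

text \<open>
  Write \<open>v k = F_div k \<eta>\<close> and let \<open>d m\<close> be the idivided power of exponent \<open>m\<close> and parity \<open>n\<close>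
  applied to \<open>\<eta>\<close>, with \<open>v k = d k = 0\<close> for negative \<open>k\<close>. The highest weight relations give
  \<open>B (v k) = [k + 1] v (k + 1) + q^(2k - n - 1) [n - k + 1] v (k - 1)\<close>, and the definition of the
  idivided powers gives \<open>B (d m) = [m + 1] d (m + 1) + \<epsilon> [m] d (m - 1)\<close> with \<open>\<epsilon> = 1\<close> or \<open>0\<close> according
  to whether \<open>m\<close> and \<open>n\<close> have equal parity. Comparing coefficients, the right-hand sides of the claim
  satisfy the recurrence of \<open>v\<close>, which together with \<open>v 0 = \<eta>\<close> determines it because \<open>q\<close> is not a
  root of unity.
\<close>

section \<open>Quantum integers and quantum binomials\<close>

lemma qint_diff:
  assumes "q \<noteq> 0"
  shows "qint q (a - b) = q powi b * qint q a - q powi a * qint q b"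
  using assms
  by (simp add: qint_def power_int_diff power_int_add power_int_minus divide_simps)
     (simp add: algebra_simps)

text \<open>A polynomial identity in the powers \<open>A\<close>, \<open>B\<close>, \<open>C\<close>
  and their inverses, modulo \<open>C * inverse C = 1\<close>. The case c = 1 drives the computation
  of \<open>E\<close> on the divided powers; a general c is needed for the coefficient
  recurrence.\<close>

lemma qint_mult_diff:
  assumes "q \<noteq> 0"
  shows "qint q (a - c) * qint q (b + c) - qint q a * qint q b = qint q c * qint q (a - b - c)"
proof -
  define A B C d where "A = q powi a" and "B = q powi b" and "C = q powi c"
    and "d = 1 / (q - inverse q)"
  have nz: "A \<noteq> 0" "B \<noteq> 0" "C \<noteq> 0"
    using assms by (auto simp: A_def B_def C_def)
  have qa: "qint q a = (A - inverse A) * d" "qint q b = (B - inverse B) * d"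
    "qint q c = (C - inverse C) * d"
    "qint q (a - c) = (A * inverse C - inverse A * C) * d"
    "qint q (b + c) = (B * C - inverse B * inverse C) * d"
    "qint q (a - b - c) = (A * inverse B * inverse C - inverse A * B * C) * d"
    using assms
    by (simp_all add: A_def B_def C_def d_def qint_def power_int_diff power_int_add
        power_int_minus divide_simps)
  have "C * inverse C = 1"
    using nz by simp
  then show ?thesis
    unfolding qa by algebra
qed

lemma qint_0 [simp]: "qint q 0 = 0"
  by (simp add: qint_def)

lemma qfact_0 [simp]: "qfact q 0 = 1"
  by (simp add: qfact_def)

lemma qfact_Suc: "qfact q (Suc m) = qint q (int (Suc m)) * qfact q m"
  by (simp add: qfact_def mult.commute)

text \<open>Reversing the numerator makes its factors independent of c, so passing from c to c + 1
  only appends one factor.\<close>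

lemma qbinom_add: "qbinom q (int l + int c) c = (\<Prod>s = 1..c. qint q (int l + int s) / qint q (int s))"
proof -
  have "(\<Prod>s = 1..c. qint q (int l + int c - int s + 1)) = (\<Prod>s = 1..c. qint q (int l + int s))"
    by (subst prod.atLeastAtMost_rev) (auto intro!: prod.cong simp: of_nat_diff algebra_simps)
  then show ?thesis
    by (simp add: qbinom_def prod_dividef)
qed

section \<open>Quantum integers for q not a root of unity\<close>

locale generic_parameter =
  fixes q :: "'k::field"
  assumes q_nonzero: "q \<noteq> 0"
    and q_power_neq_1: "m > 0 \<Longrightarrow> q ^ m \<noteq> 1"
begin

lemma q_diff_nonzero: "q - inverse q \<noteq> 0"
  using q_nonzero q_power_neq_1[of 2] by (auto simp: power2_eq_square field_simps)

lemma qint_1 [simp]: "qint q 1 = 1"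
  using q_diff_nonzero by (simp add: qint_def power_int_minus)

text \<open>A vanishing [m] would force q^(2m) = 1.\<close>

lemma qint_nonzero:
  assumes "m > 0"
  shows "qint q m \<noteq> 0"
proof
  assume "qint q m = 0"
  then have "q powi m = q powi (- m)"
    using q_diff_nonzero by (simp add: qint_def)
  then have "q powi (m + m) = q powi m * q powi (- m)"
    using q_nonzero by (metis power_int_add)
  also have "\<dots> = 1"
    using q_nonzero by (simp add: power_int_minus)
  finally have "q powi (m + m) = 1" .
  then have "q ^ nat (m + m) = 1"
    using assms by (simp add: power_int_def)
  then show False
    using q_power_neq_1[of "nat (m + m)"] assms by simp
qed

lemma qfact_nonzero: "qfact q m \<noteq> 0"
  by (induction m) (auto simp: qfact_Suc qint_nonzero simp del: of_nat_Suc)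

lemma qint_power2: "qint (q ^ 2) m = qint q (2 * m) / qint q 2"
proof -
  have "(q ^ 2) powi k = q powi (2 * k)" for k
    by (simp add: power_int_mult)
  then show ?thesis
    using q_diff_nonzero by (simp add: qint_def power_int_minus)
qed

text \<open>The factor appended in \<open>qbinom_add\<close>, with denominators cleared; the [2]
  from \<open>qint_power2\<close> cancels.\<close>

lemma qbinom_Suc:
  "qint q (2 * int (Suc c)) * qbinom (q ^ 2) (int l + int (Suc c)) (Suc c) =
   qint q (2 * (int l + int c + 1)) * qbinom (q ^ 2) (int l + int c) c"
  unfolding qbinom_add
  using qint_nonzero[of 2] qint_nonzero[of "2 * int (Suc c)"]
  by (simp add: qint_power2 field_simps)

lemma qbinom_Suc':
  "qint q (2 * (int l + 1)) * qbinom (q ^ 2) (int (Suc l) + int c) c =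
   qint q (2 * (int l + int c + 1)) * qbinom (q ^ 2) (int l + int c) c"
proof (induction c)
  case (Suc c)
  \<comment> \<open>Multiplying by the nonzero [2(c + 1)] lets \<open>qbinom_Suc\<close> pass
    between c + 1 and c, first for \<open>Suc l\<close>, then for \<open>l\<close>; the factor is
    cancelled at the end.\<close>
  have "qint q (2 * int (Suc c)) * (qint q (2 * (int l + 1)) * qbinom (q ^ 2) (int (Suc l) + int (Suc c)) (Suc c))
    = qint q (2 * (int (Suc l) + int c + 1)) * (qint q (2 * (int l + 1)) * qbinom (q ^ 2) (int (Suc l) + int c) c)"
    using arg_cong[OF qbinom_Suc[of c "Suc l"], of "(*) (qint q (2 * (int l + 1)))"]
    by (simp only: mult.left_commute)
  also have "\<dots> = qint q (2 * (int (Suc l) + int c + 1)) *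
      (qint q (2 * int (Suc c)) * qbinom (q ^ 2) (int l + int (Suc c)) (Suc c))"
    unfolding Suc.IH qbinom_Suc ..
  also have "2 * (int (Suc l) + int c + 1) = 2 * (int l + int (Suc c) + 1)"
    by simp
  finally show ?case
    using qint_nonzero[of "2 * int (Suc c)"] by (simp add: ac_simps del: of_nat_Suc)
qed (simp add: qbinom_def)

lemma qbinom_Suc_shift:
  "qint q (2 * (int l + 1)) * qbinom (q ^ 2) (int (Suc l) + int c) c =
   qint q (2 * int (Suc c)) * qbinom (q ^ 2) (int l + int (Suc c)) (Suc c)"
  unfolding qbinom_Suc' qbinom_Suc ..

section \<open>Coefficient recurrences\<close>

text \<open>
  The first identity has coefficients \<open>icoeff 1 l\<close>, the second \<open>icoeff 3 l\<close>. In the recurrences below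
  \<open>N\<close> stands for the index of \<open>v\<close>: \<open>n - 2 l\<close> in the first and \<open>n - 2 (l + 1)\<close> in the second.
\<close>

definition icoeff :: "int \<Rightarrow> nat \<Rightarrow> nat \<Rightarrow> 'k" where
  "icoeff e l c = (-1) ^ c * q powi (- ((2 * int l + e) * int c)) * qbinom (q ^ 2) (int l + int c) c"

lemma icoeff_0 [simp]: "icoeff e l 0 = 1"
  by (simp add: icoeff_def qbinom_def)

text \<open>Compares coefficients of \<open>d (N - 2 * c)\<close> in \<open>B (v (N - 1))\<close>.
  Up to the common factor (-1)^c \<open>x\<close> \<open>\<beta>\<close> this is
  \<open>qint_diff\<close> for N and 2c.\<close>

lemma icoeff_odd_recurrence:
  "qint q (N - 2 * int c) * icoeff 3 l c =
   qint q N * icoeff 1 l c +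
   q powi (N - 2 * int l - 3) * qint q (2 * int l + 2) * (if c = 0 then 0 else icoeff 1 (Suc l) (c - 1))"
proof (cases c)
  case (Suc d)
  define \<beta> x where "\<beta> = qbinom (q ^ 2) (int l + int c) c" and "x = q powi (- ((2 * int l + 3) * int c))"
  have \<beta>: "qint q (2 * int l + 2) * qbinom (q ^ 2) (int (Suc l) + int d) d = qint q (2 * int c) * \<beta>"
    using qbinom_Suc_shift[of l d] by (simp add: \<beta>_def Suc)
  have e1: "q powi (- ((2 * int l + 1) * int c)) = x * q powi (2 * int c)"
    unfolding x_def using q_nonzero by (simp add: algebra_simps flip: power_int_add)
  have e2: "q powi (N - 2 * int l - 3) * q powi (- ((2 * int (Suc l) + 1) * int d)) = x * q powi N"
    unfolding x_def using q_nonzero by (simp add: Suc algebra_simps flip: power_int_add)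
  have "q powi (N - 2 * int l - 3) * qint q (2 * int l + 2) * icoeff 1 (Suc l) d =
    (-1) ^ d * (q powi (N - 2 * int l - 3) * q powi (- ((2 * int (Suc l) + 1) * int d))) *
    (qint q (2 * int l + 2) * qbinom (q ^ 2) (int (Suc l) + int d) d)"
    unfolding icoeff_def by (simp only: ac_simps)
  also have "\<dots> = (-1) ^ d * (x * q powi N) * (qint q (2 * int c) * \<beta>)"
    unfolding \<beta> e2 ..
  finally have *: "q powi (N - 2 * int l - 3) * qint q (2 * int l + 2) * icoeff 1 (Suc l) d =
    - ((-1) ^ c * x * \<beta> * (q powi N * qint q (2 * int c)))"
    by (simp add: Suc)
  have "icoeff 3 l c = (-1) ^ c * x * \<beta>" "icoeff 1 l c = (-1) ^ c * x * \<beta> * q powi (2 * int c)"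
    unfolding icoeff_def e1 by (simp_all add: x_def \<beta>_def)
  with * qint_diff[OF q_nonzero, of N "2 * int c"] show ?thesis
    by (simp add: Suc) (simp add: algebra_simps)
qed simp

text \<open>Compares coefficients of \<open>d (N + 1 - 2 * c)\<close> in \<open>B (v N)\<close>.
  Since N has the parity of n, \<open>B\<close> contributes two terms to the left-hand side.\<close>

lemma icoeff_even_recurrence:
  "qint q (N + 1 - 2 * int c) * icoeff 1 (Suc l) c +
   qint q (N + 2 - 2 * int c) * (if c = 0 then 0 else icoeff 1 (Suc l) (c - 1)) =
   qint q (N + 1) * icoeff 3 l c +
   q powi (N - 2 * int l - 3) * qint q (2 * int l + 3) * (if c = 0 then 0 else icoeff 3 (Suc l) (c - 1))"
proof (cases c)
  case (Suc d)
  \<comment> \<open>Multiplication by [L] turns the other two binomials that occur into multiples of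
    \<open>\<beta>\<close>.\<close>
  define L where "L = 2 * (int l + int c + 1)"
  define \<beta> x where "\<beta> = qbinom (q ^ 2) (int (Suc l) + int c) c" and "x = q powi (- ((2 * int l + 3) * int c))"
  have L: "qint q L \<noteq> 0"
    by (rule qint_nonzero) (simp add: L_def)
  have \<beta>1: "qint q L * qbinom (q ^ 2) (int l + int c) c = qint q (2 * int l + 2) * \<beta>"
    using qbinom_Suc'[of l c] by (simp add: \<beta>_def L_def)
  have \<beta>2: "qint q L * qbinom (q ^ 2) (int (Suc l) + int d) d = qint q (2 * int c) * \<beta>"
    using qbinom_Suc[of d "Suc l"] by (simp add: \<beta>_def L_def Suc algebra_simps)
  have e1: "q powi (- ((2 * int (Suc l) + 1) * int d)) = x * q powi (2 * int l + 3)"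
    unfolding x_def using q_nonzero by (simp add: Suc algebra_simps flip: power_int_add)
  have e2: "q powi (N - 2 * int l - 3) * q powi (- ((2 * int (Suc l) + 3) * int d)) =
     x * q powi (N + 2 - 2 * int c)"
    unfolding x_def using q_nonzero by (simp add: Suc algebra_simps flip: power_int_add)
  define y where "y = (-1) ^ c * x * \<beta>"
  have m: "(-1) ^ d = - ((-1) ^ c :: 'k)"
    by (simp add: Suc)
  have 1: "icoeff 1 (Suc l) c = y"
    by (simp add: icoeff_def y_def x_def \<beta>_def algebra_simps)
  have "qint q L * icoeff 1 (Suc l) d = (-1) ^ d * q powi (- ((2 * int (Suc l) + 1) * int d)) *
    (qint q L * qbinom (q ^ 2) (int (Suc l) + int d) d)"
    by (simp only: icoeff_def ac_simps)
  then have 2: "qint q L * icoeff 1 (Suc l) d = - (y * (q powi (2 * int l + 3) * qint q (2 * int c)))"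
    unfolding \<beta>2 e1 m y_def by (simp add: ac_simps)
  have "qint q L * icoeff 3 l c = (-1) ^ c * x * (qint q L * qbinom (q ^ 2) (int l + int c) c)"
    by (simp only: icoeff_def x_def ac_simps)
  then have 3: "qint q L * icoeff 3 l c = y * qint q (2 * int l + 2)"
    unfolding \<beta>1 y_def by (simp add: ac_simps)
  have "qint q L * (q powi (N - 2 * int l - 3) * qint q (2 * int l + 3) * icoeff 3 (Suc l) d) =
    qint q (2 * int l + 3) * (-1) ^ d *
    (q powi (N - 2 * int l - 3) * q powi (- ((2 * int (Suc l) + 3) * int d))) *
    (qint q L * qbinom (q ^ 2) (int (Suc l) + int d) d)"
    by (simp only: icoeff_def ac_simps)
  then have 4: "qint q L * (q powi (N - 2 * int l - 3) * qint q (2 * int l + 3) * icoeff 3 (Suc l) d) =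
    - (y * (q powi (N + 2 - 2 * int c) * qint q (2 * int l + 3) * qint q (2 * int c)))"
    unfolding \<beta>2 e2 m y_def by (simp add: ac_simps)
  have 5: "qint q (N + 1 - 2 * int c) * qint q L =
      qint q (N + 1) * qint q (2 * int l + 2) + qint q (2 * int c) * qint q (N - 1 - 2 * int l - 2 * int c)"
    using qint_mult_diff[OF q_nonzero, of "N + 1" "2 * int c" "2 * int l + 2"]
    by (simp add: L_def algebra_simps)
  have 6: "qint q (N - 1 - 2 * int l - 2 * int c) =
      q powi (2 * int l + 3) * qint q (N + 2 - 2 * int c) - q powi (N + 2 - 2 * int c) * qint q (2 * int l + 3)"
    using qint_diff[OF q_nonzero, of "N + 2 - 2 * int c" "2 * int l + 3"] by (simp add: algebra_simps)
  have "qint q L * (qint q (N + 1 - 2 * int c) * icoeff 1 (Suc l) c +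
      qint q (N + 2 - 2 * int c) * icoeff 1 (Suc l) d) =
    qint q L * (qint q (N + 1) * icoeff 3 l c +
      q powi (N - 2 * int l - 3) * qint q (2 * int l + 3) * icoeff 3 (Suc l) d)"
  proof -
    \<comment> \<open>With quantum integers and powers of q replaced by indeterminates, the claim
      follows from facts 2 to 6 by polynomial algebra.\<close>
    have "L * (A * y + B * a) = L * (M * b + X)"
      if "L * a = - (y * (p * r))" "L * b = y * t" "L * X = - (y * (g * h * r))"
        "A * L = M * t + r * s" "s = p * B - g * h" for L A B M X a b p r t g h s :: 'k
      using that by algebra
    from this[OF 2 3 4 5 6] show ?thesis
      unfolding 1 .
  qed
  with L show ?thesis
    by (simp add: Suc)
qed simp

end

section \<open>Linear operators on a module and products of factors B^2 - [r]^2\<close>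

context Uq_sl2_module
begin

sublocale E: Vector_Spaces.linear scale scale E
  by (fact linear_E)

sublocale F: Vector_Spaces.linear scale scale F
  by (fact linear_F)

sublocale K: Vector_Spaces.linear scale scale K
  by (fact linear_K)

sublocale K': Vector_Spaces.linear scale scale K'
  by (fact linear_K')

abbreviation B :: "'v \<Rightarrow> 'v" where "B \<equiv> B_op scale q E F K'"

sublocale B: Vector_Spaces.linear scale scale B
  by unfold_locales
    (simp_all add: B_op_def E.add F.add K'.add E.scale F.scale K'.scale scale_right_distrib
      scale_left_commute)

lemma B_prod_Nil: "B_prod scale q f [] v = v"
  by (simp add: B_prod_def)

text \<open>The last list entry acts first. Splitting there fits the lists
  \<open>[1..<i + 1]\<close>, which grow at the end.\<close>

lemma B_prod_snoc:
  "B_prod scale q f (rs @ [r]) v = B_prod scale q f rs (f (f v) - scale (qint q (int r) ^ 2) v)"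
proof -
  have "foldr (\<circ>) (map G rs) g x = foldr (\<circ>) (map G rs) id (g x)" for G :: "nat \<Rightarrow> 'v \<Rightarrow> 'v" and g x
    by (induction rs) auto
  then show ?thesis
    by (simp add: B_prod_def numeral_2_eq_2)
qed

lemma B_prod_scale: "B_prod scale q B rs (scale a v) = scale a (B_prod scale q B rs v)"
proof (induction rs arbitrary: v rule: rev_induct)
  case (snoc r rs)
  have "B (B (scale a v)) - scale (qint q (int r) ^ 2) (scale a v) =
      scale a (B (B v) - scale (qint q (int r) ^ 2) v)"
    by (simp only: B.scale scale_right_diff_distrib scale_left_commute)
  then show ?case
    by (simp only: B_prod_snoc snoc.IH)
qed (simp add: B_prod_Nil)

lemma B_prod_diff:
  "B_prod scale q B rs (v - w) = B_prod scale q B rs v - B_prod scale q B rs w"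
proof (induction rs arbitrary: v w rule: rev_induct)
  case (snoc r rs)
  show ?case
    by (simp add: B_prod_snoc B.diff scale_right_diff_distrib snoc.IH)
qed (simp add: B_prod_Nil)

lemma B_prod_B: "B_prod scale q B rs (B v) = B (B_prod scale q B rs v)"
  by (induction rs arbitrary: v rule: rev_induct)
    (simp_all add: B_prod_Nil B_prod_snoc flip: B.scale B.diff)

text \<open>All factors are polynomials in \<open>B\<close>, so the innermost one may be moved to
  the outside.\<close>

lemma B_prod_snoc_B:
  "B_prod scale q B (rs @ [r]) v =
   B (B (B_prod scale q B rs v)) - scale (qint q (int r) ^ 2) (B_prod scale q B rs v)"
  by (simp add: B_prod_snoc B_prod_diff B_prod_scale B_prod_B)

text \<open>Here and in the next three lemmas the cases are arranged so that exponents 2i + 1 and 2i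
  + 2 (even p), or 2i and 2i + 1 (odd p), share the same product.\<close>

lemma B_idiv_even_odd:
  assumes "even p"
  shows "B_idiv scale q B p (2 * i + 1) v =
    scale (1 / qfact q (2 * i + 1)) (B (B_prod scale q B (map (\<lambda>r. 2 * r) [1..<i + 1]) v))"
proof -
  have "(2 * i + 1 + 1) div 2 = i + 1" "odd (2 * i + 1)"
    by simp_all
  with assms show ?thesis
    by (simp add: B_idiv_def del: upt_Suc)
qed

lemma B_idiv_even_even:
  assumes "even p"
  shows "B_idiv scale q B p (2 * i + 2) v =
    scale (1 / qfact q (2 * i + 2)) (B (B (B_prod scale q B (map (\<lambda>r. 2 * r) [1..<i + 1]) v)))"
proof -
  have 1: "(2 * i + 2 + 1) div 2 = i + 1" "1 + of_bool (even (2 * i + 2)) = Suc (Suc 0)" "2 * i + 2 \<noteq> 0"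
    by simp_all
  show ?thesis
    unfolding B_idiv_def 1 using assms by (simp del: upt_Suc)
qed

lemma B_idiv_odd_even:
  assumes "odd p"
  shows "B_idiv scale q B p (2 * i) v =
    scale (1 / qfact q (2 * i)) (B_prod scale q B (map (\<lambda>r. 2 * r - 1) [1..<i + 1]) v)"
proof (cases "i = 0")
  case False
  then have 1: "2 * i div 2 + 1 = i + 1" "of_bool (odd (2 * i)) = (0 :: nat)" "2 * i \<noteq> 0"
    by simp_all
  show ?thesis
    unfolding B_idiv_def 1 using assms False by (simp del: upt_Suc)
qed (simp add: B_idiv_def B_prod_Nil)

lemma B_idiv_odd_odd:
  assumes "odd p"
  shows "B_idiv scale q B p (2 * i + 1) v =
    scale (1 / qfact q (2 * i + 1)) (B (B_prod scale q B (map (\<lambda>r. 2 * r - 1) [1..<i + 1]) v))"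
proof -
  have "(2 * i + 1) div 2 + 1 = i + 1" "odd (2 * i + 1)"
    by simp_all
  with assms show ?thesis
    by (simp add: B_idiv_def del: upt_Suc)
qed

end

section \<open>\<open>F\<close> on divided powers and \<open>B\<close> on idivided powers\<close>

locale generic_Uq_sl2_module = Uq_sl2_module scale q E F K K' + generic_parameter q
  for scale :: "'k::field \<Rightarrow> 'v::ab_group_add \<Rightarrow> 'v"
    and q :: 'k and E F K K' :: "'v \<Rightarrow> 'v"
begin

lemma F_F_div: "F (F_div scale q F k v) = scale (qint q (k + 1)) (F_div scale q F (k + 1) v)"
proof (cases "k \<ge> 0")
  case True
  then obtain m where k: "k = int m"
    using nonneg_int_cases by blast
  have m: "k + 1 = int (Suc m)"
    by (simp add: k)
  show ?thesis
    using qint_nonzero[of "int (Suc m)"] unfolding m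
    by (simp add: F_div_def k qfact_Suc F.scale del: of_nat_Suc)
next
  case False
  \<comment> \<open>At k = -1 the factor [0] annihilates the possibly nonzero \<open>F_div\<close>
    of exponent 0.\<close>
  then have "k + 1 = 0 \<or> k + 1 < 0" by linarith
  with False show ?thesis
    by (auto simp: F_div_def F.zero)
qed

text \<open>For positive m, the product for m + 1 has exactly the factor B^2 - [m]^2 more than the
  one for m - 1, and \<open>B\<close> maps the idivided power of exponent m - 1 to [m] times that of
  exponent m.\<close>

lemma B_B_idiv_same_parity:
  assumes "even m = even p"
  shows "B (B_idiv scale q B p m v) =
    scale (qint q (int m + 1)) (B_idiv scale q B p (m + 1) v) +
    scale (qint q (int m)) (B_idiv scale q B p (m - 1) v)"
proof (cases "even p")
  case True
  then obtain j where m: "m = 2 * j"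
    using assms by (auto elim: evenE)
  show ?thesis
  proof (cases j)
    \<comment> \<open>Here m = 0: truncated subtraction makes m - 1 equal to 0, but the factor [0]
      removes that term.\<close>
    case 0
    then show ?thesis
      using True by (simp add: m B_idiv_def qfact_Suc B_prod_Nil)
  next
    case (Suc i)
    define P where "P = B_prod scale q B (map (\<lambda>r. 2 * r) [1..<i + 1]) v"
    define f where "f = qfact q (2 * i + 1)"
    define x y where "x = qint q (int (2 * i + 2))" and "y = qint q (int (2 * i + 3))"
    have nz: "f \<noteq> 0" "x \<noteq> 0" "y \<noteq> 0"
      by (simp_all add: f_def x_def y_def qfact_nonzero qint_nonzero del: of_nat_add)
    have f: "qfact q (2 * i + 2) = x * f" "qfact q (2 * i + 3) = y * (x * f)"
      using qfact_Suc[of q "2 * i + 1"] qfact_Suc[of q "2 * i + 2"]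
      by (simp_all add: f_def x_def y_def numeral_3_eq_3)
    have 1: "B_idiv scale q B p (2 * i + 1) v = scale (1 / f) (B P)"
      unfolding P_def f_def by (rule B_idiv_even_odd[OF True])
    have 2: "B_idiv scale q B p (2 * i + 2) v = scale (1 / (x * f)) (B (B P))"
      unfolding P_def f[symmetric] by (rule B_idiv_even_even[OF True])
    have "B_prod scale q B (map (\<lambda>r. 2 * r) [1..<i + 1 + 1]) v = B (B P) - scale (x ^ 2) P"
      by (simp add: B_prod_snoc_B P_def x_def)
    then have 3: "B_idiv scale q B p (2 * i + 3) v = scale (1 / (y * (x * f))) (B (B (B P)) - scale (x ^ 2) (B P))"
      using B_idiv_even_odd[OF True, of "i + 1" v] f by (simp add: B.diff B.scale numeral_3_eq_3)
    have m': "m = 2 * i + 2" "m + 1 = 2 * i + 3" "m - 1 = 2 * i + 1"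
      "int m + 1 = int (2 * i + 3)"
      by (simp_all add: m Suc)
    have "B (B_idiv scale q B p (2 * i + 2) v) =
        scale y (B_idiv scale q B p (2 * i + 3) v) + scale x (B_idiv scale q B p (2 * i + 1) v)"
      using nz unfolding 1 2 3 by (simp add: B.scale scale_right_diff_distrib power2_eq_square)
    then show ?thesis
      unfolding m'(2-4) unfolding m'(1) x_def y_def .
  qed
next
  case False
  then obtain i where m: "m = 2 * i + 1"
    using assms by (auto elim: oddE)
  define P where "P = B_prod scale q B (map (\<lambda>r. 2 * r - 1) [1..<i + 1]) v"
  define f where "f = qfact q (2 * i)"
  define x y where "x = qint q (int (2 * i + 1))" and "y = qint q (int (2 * i + 2))"
  have nz: "f \<noteq> 0" "x \<noteq> 0" "y \<noteq> 0"
    by (simp_all add: f_def x_def y_def qfact_nonzero qint_nonzero del: of_nat_add)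
  have f: "qfact q (2 * i + 1) = x * f" "qfact q (2 * i + 2) = y * (x * f)"
    using qfact_Suc[of q "2 * i"] qfact_Suc[of q "2 * i + 1"] by (simp_all add: f_def x_def y_def)
  have 1: "B_idiv scale q B p (2 * i) v = scale (1 / f) P"
    unfolding P_def f_def by (rule B_idiv_odd_even[OF False])
  have 2: "B_idiv scale q B p (2 * i + 1) v = scale (1 / (x * f)) (B P)"
    unfolding P_def f[symmetric] by (rule B_idiv_odd_odd[OF False])
  have "B_prod scale q B (map (\<lambda>r. 2 * r - 1) [1..<i + 1 + 1]) v = B (B P) - scale (x ^ 2) P"
    by (simp add: B_prod_snoc_B P_def x_def)
  then have 3: "B_idiv scale q B p (2 * i + 2) v = scale (1 / (y * (x * f))) (B (B P) - scale (x ^ 2) P)"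
    using B_idiv_odd_even[OF False, of "i + 1" v] f by simp
  have m': "m + 1 = 2 * i + 2" "m - 1 = 2 * i"
    "int m + 1 = int (2 * i + 2)"
    by (simp_all add: m)
  have "B (B_idiv scale q B p (2 * i + 1) v) =
      scale y (B_idiv scale q B p (2 * i + 2) v) + scale x (B_idiv scale q B p (2 * i) v)"
    using nz unfolding 1 2 3 by (simp add: B.scale scale_right_diff_distrib power2_eq_square)
  then show ?thesis
    unfolding m' unfolding m x_def y_def .
qed

text \<open>The exponents m and m + 1 share the same product, and m + 1 has one more factor
  \<open>B\<close>.\<close>

lemma B_B_idiv_other_parity:
  assumes "even m \<noteq> even p"
  shows "B (B_idiv scale q B p m v) = scale (qint q (int m + 1)) (B_idiv scale q B p (m + 1) v)"
proof -
  have nz: "qint q (int (Suc m)) \<noteq> 0"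
    by (simp add: qint_nonzero del: of_nat_Suc)
  have m: "int m + 1 = int (Suc m)"
    by simp
  show ?thesis
  proof (cases "even p")
    case True
    with assms obtain i where i: "m = 2 * i + 1"
      by (auto elim: oddE)
    show ?thesis
      using nz B_idiv_even_odd[OF True, of i v] B_idiv_even_even[OF True, of i v]
      unfolding m by (simp add: i qfact_Suc B.scale del: upt_Suc of_nat_Suc)
  next
    case False
    with assms obtain i where i: "m = 2 * i"
      by (auto elim: evenE)
    show ?thesis
      using nz B_idiv_odd_even[OF False, of i v] B_idiv_odd_odd[OF False, of i v]
      unfolding m by (simp add: i qfact_Suc B.scale del: upt_Suc of_nat_Suc)
  qed
qed

end

section \<open>Action of the generators and of \<open>B\<close> on a highest weight vector\<close>

locale highest_weight_vector = generic_Uq_sl2_module scale q E F K K'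
  for scale :: "'k::field \<Rightarrow> 'v::ab_group_add \<Rightarrow> 'v"
    and q :: 'k and E F K K' :: "'v \<Rightarrow> 'v" +
  fixes n :: nat and \<eta> :: 'v
  assumes K_eta: "K \<eta> = scale (q ^ n) \<eta>"
    and E_eta: "E \<eta> = 0"
begin

abbreviation v :: "int \<Rightarrow> 'v" where
  "v k \<equiv> F_div scale q F k \<eta>"

lemma K_v: "K (v k) = scale (q powi (int n - 2 * k)) (v k)"
proof (cases "k \<ge> 0")
  case True
  have "K ((F ^^ m) \<eta>) = scale (q powi (int n - 2 * int m)) ((F ^^ m) \<eta>)" for m
  proof (induction m)
    case (Suc m)
    have "q powi (- 2) * q powi (int n - 2 * int m) = q powi (int n - 2 * int (Suc m))"
      using q_nonzero by (simp add: algebra_simps flip: power_int_add)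
    then show ?case
      by (simp add: K_F Suc.IH F.scale)
  qed (simp add: K_eta)
  from this[of "nat k"] True show ?thesis
    by (simp add: F_div_def K.scale mult.commute)
qed (simp add: F_div_def K.zero)

lemma K'_v: "K' (v k) = scale (q powi (2 * k - int n)) (v k)"
proof -
  have "v k = scale (q powi (int n - 2 * k)) (K' (v k))"
    using K'_K[of "v k"] by (simp add: K_v K'.scale)
  then have "scale (q powi (2 * k - int n)) (v k) =
      scale (q powi (2 * k - int n) * q powi (int n - 2 * k)) (K' (v k))"
    by (metis scale_scale)
  also have "q powi (2 * k - int n) * q powi (int n - 2 * k) = 1"
    using q_nonzero by (simp flip: power_int_add)
  finally show ?thesis
    by simp
qed

text \<open>Induction on k: the commutator of \<open>E\<close> and \<open>F\<close> contributes
  [n - 2k], \<open>qint_mult_diff\<close> combines the terms into [k + 1][n - k], and [k + 1] is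
  cancelled.\<close>

lemma E_v: "E (v k) = scale (qint q (int n - k + 1)) (v (k - 1))"
proof (cases "k \<ge> 0")
  case True
  have "E (v (int m)) = scale (qint q (int n - int m + 1)) (v (int m - 1))" for m
  proof (induction m)
    case 0
    show ?case by (simp add: F_div_def E_eta)
  next
    case (Suc m)
    let ?k = "int m"
    have "scale (qint q (?k + 1)) (E (v (?k + 1))) = E (F (v ?k))"
      by (simp add: F_F_div E.scale)
    also have "\<dots> = F (E (v ?k)) + scale (1 / (q - inverse q)) (K (v ?k) - K' (v ?k))"
      using E_F[of "v ?k"] by (simp add: algebra_simps)
    also have "K (v ?k) - K' (v ?k) =
        scale (q powi (int n - 2 * ?k) - q powi (- (int n - 2 * ?k))) (v ?k)"
      by (simp add: K_v K'_v scale_left_diff_distrib)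
    also have "F (E (v ?k)) = scale (qint q (int n - ?k + 1) * qint q ?k) (v ?k)"
      using F_F_div[of "?k - 1" \<eta>] by (simp add: Suc.IH F.scale)
    also have "scale (qint q (int n - ?k + 1) * qint q ?k) (v ?k) +
        scale (1 / (q - inverse q)) (scale (q powi (int n - 2 * ?k) - q powi (- (int n - 2 * ?k))) (v ?k))
      = scale (qint q (int n - ?k + 1) * qint q ?k + qint q (int n - 2 * ?k)) (v ?k)"
      by (simp add: scale_left_distrib qint_def)
    also have "qint q (int n - ?k + 1) * qint q ?k + qint q (int n - 2 * ?k) =
        qint q (?k + 1) * qint q (int n - ?k)"
      using qint_mult_diff[OF q_nonzero, of "int n - ?k + 1" 1 ?k] by (simp add: algebra_simps)
    finally have "scale (qint q (?k + 1)) (E (v (?k + 1))) =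
        scale (qint q (?k + 1)) (scale (qint q (int n - ?k)) (v ?k))"
      by simp
    moreover have "qint q (?k + 1) \<noteq> 0"
      by (simp add: qint_nonzero)
    ultimately have "E (v (?k + 1)) = scale (qint q (int n - ?k)) (v ?k)"
      by (rule scale_left_imp_eq[rotated])
    then show ?case by (simp add: add.commute)
  qed
  from this[of "nat k"] True show ?thesis by simp
qed (simp add: F_div_def E.zero)

text \<open>The power of q collects the parameter q^(-1) and the eigenvalue of \<open>K'\<close> on
  \<open>v k\<close>.\<close>

lemma B_v:
  "B (v k) = scale (qint q (k + 1)) (v (k + 1)) +
     scale (q powi (2 * k - int n - 1) * qint q (int n - k + 1)) (v (k - 1))"
proof -
  have "inverse q * q powi (2 * k - int n) = q powi (2 * k - int n - 1)"
    using q_nonzero power_int_add[of q "- 1" "2 * k - int n"] by (simp add: power_int_minus)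
  then show ?thesis
    by (simp add: B_op_def F_F_div K'_v E.scale E_v flip: mult.assoc)
qed

definition d :: "int \<Rightarrow> 'v" where
  "d m = (if m < 0 then 0 else B_idiv scale q B n (nat m) \<eta>)"

lemma d_0 [simp]: "d 0 = \<eta>"
  by (simp add: d_def B_idiv_def)

lemma B_d:
  "B (d m) = scale (qint q (m + 1)) (d (m + 1)) +
     (if even (m - int n) then scale (qint q m) (d (m - 1)) else 0)"
proof (cases "m \<ge> 0")
  case True
  then obtain i where m: "m = int i"
    using nonneg_int_cases by blast
  have "nat (int i + 1) = i + 1" "nat (int i - 1) = i - 1" "even (int i - int n) \<longleftrightarrow> even i = even n"
    by auto
  \<comment> \<open>At i = 0 the integer index is -1 while the natural one is 0; the factor [0]
    reconciles them.\<close>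
  moreover have "scale (qint q (int i)) (d (int i - 1)) =
      scale (qint q (int i)) (B_idiv scale q B n (i - 1) \<eta>)"
    by (cases i) (auto simp: d_def)
  ultimately show ?thesis
    using B_B_idiv_same_parity[of i n \<eta>] B_B_idiv_other_parity[of i n \<eta>]
    by (simp add: m) (simp add: d_def)
next
  case False
  then have "m + 1 = 0 \<or> m + 1 < 0" by linarith
  with False show ?thesis
    by (auto simp: d_def B.zero)
qed

section \<open>Linear combinations of idivided powers\<close>

text \<open>The range does not depend on k, which eases adding and shifting. For k \<le> n it
  contains every c with 2c \<le> k, and the remaining terms vanish because \<open>d\<close> is 0 at
  negative indices.\<close>

definition dsum :: "(nat \<Rightarrow> 'k) \<Rightarrow> int \<Rightarrow> 'v" where
  "dsum f k = (\<Sum>c\<le>n. scale (f c) (d (k - 2 * int c)))"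

text \<open>Reindexing c to c + 1; the bound on k makes the term at c = n vanish, so the range can
  stay fixed.\<close>

lemma dsum_shift:
  assumes "k \<le> int n"
  shows "dsum f (k - 2) = dsum (\<lambda>c. if c = 0 then 0 else f (c - 1)) k"
proof -
  have "d (k - 2 - 2 * int n) = 0"
    using assms by (simp add: d_def)
  then have "dsum f (k - 2) = (\<Sum>c<n. scale (f c) (d (k - 2 - 2 * int c)))"
    by (simp add: dsum_def flip: lessThan_Suc_atMost)
  also have "\<dots> = (\<Sum>c<n. scale (f c) (d (k - 2 * int (Suc c))))"
    by (simp add: algebra_simps)
  also have "\<dots> = dsum (\<lambda>c. if c = 0 then 0 else f (c - 1)) k"
    unfolding dsum_def by (simp add: sum.atMost_shift)
  finally show ?thesis .
qed

lemma dsum_add: "dsum f k + dsum g k = dsum (\<lambda>c. f c + g c) k"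
  by (simp add: dsum_def scale_left_distrib sum.distrib)

lemma dsum_scale: "scale a (dsum f k) = dsum (\<lambda>c. a * f c) k"
  by (simp add: dsum_def scale_sum_right)

text \<open>By \<open>B_d\<close> each term splits into indices k + 1 - 2c and k - 1 - 2c;
  \<open>dsum_shift\<close> brings the second family to k + 1.\<close>

lemma B_dsum_same_parity:
  assumes "k < int n" "even (k - int n)"
  shows "B (dsum f k) =
    dsum (\<lambda>c. qint q (k + 1 - 2 * int c) * f c +
      qint q (k + 2 - 2 * int c) * (if c = 0 then 0 else f (c - 1))) (k + 1)"
proof -
  have "even (k - 2 * int c - int n)" for c
    using assms by auto
  then have "B (dsum f k) = dsum (\<lambda>c. qint q (k + 1 - 2 * int c) * f c) (k + 1) +
     dsum (\<lambda>c. qint q (k - 2 * int c) * f c) (k + 1 - 2)"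
    by (simp add: dsum_def B.sum B.scale B_d scale_right_distrib sum.distrib algebra_simps)
  also have "dsum (\<lambda>c. qint q (k - 2 * int c) * f c) (k + 1 - 2) =
     dsum (\<lambda>c. qint q (k + 2 - 2 * int c) * (if c = 0 then 0 else f (c - 1))) (k + 1)"
    using assms(1) by (subst dsum_shift) (auto simp: dsum_def of_nat_diff algebra_simps intro!: sum.cong)
  finally show ?thesis
    by (simp add: dsum_add)
qed

lemma B_dsum_other_parity:
  assumes "odd (k - int n)"
  shows "B (dsum f k) = dsum (\<lambda>c. qint q (k + 1 - 2 * int c) * f c) (k + 1)"
proof -
  have "odd (k - 2 * int c - int n)" for c
    using assms by auto
  then show ?thesis
    by (simp add: dsum_def B.sum B.scale B_d algebra_simps)
qed

lemma dsum_neg: "k < 0 \<Longrightarrow> dsum f k = 0"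
  by (simp add: dsum_def d_def)

lemma dsum_0:
  assumes "f 0 = 1"
  shows "dsum f 0 = \<eta>"
proof -
  have "dsum f 0 = (\<Sum>c\<in>{0}. scale (f c) (d (0 - 2 * int c)))"
    unfolding dsum_def by (intro sum.mono_neutral_right) (auto simp: d_def)
  with assms show ?thesis by simp
qed

lemma v_neg: "k < 0 \<Longrightarrow> v k = 0"
  by (simp add: F_div_def)

lemma v_0: "v 0 = \<eta>"
  by (simp add: F_div_def)

section \<open>Descending recursion on l\<close>

text \<open>With k = n - 2(l + 1), the formula for \<open>B (v k)\<close> is solved for
  \<open>v (k + 1)\<close>; the hypotheses supply \<open>v k\<close> and
  \<open>v (k - 1)\<close>.\<close>

lemma v_odd_step:
  assumes "v (int n - 2 * int (Suc l)) = dsum (icoeff 1 (Suc l)) (int n - 2 * int (Suc l))"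
    and "v (int n - 1 - 2 * int (Suc l)) = dsum (icoeff 3 (Suc l)) (int n - 1 - 2 * int (Suc l))"
  shows "v (int n - 1 - 2 * int l) = dsum (icoeff 3 l) (int n - 1 - 2 * int l)"
proof -
  define k where "k = int n - 2 * int (Suc l)"
  define a where "a = q powi (k - 2 * int l - 3) * qint q (2 * int l + 3)"
  have k: "k < int n" "even (k - int n)" "int n - 1 - 2 * int l = k + 1"
    "int n - 1 - 2 * int (Suc l) = k - 1" "k + 1 - 2 = k - 1"
    by (auto simp: k_def)
  have "2 * k - int n - 1 = k - 2 * int l - 3" "int n - k + 1 = 2 * int l + 3"
    by (simp_all add: k_def)
  then have "scale (qint q (k + 1)) (v (k + 1)) + scale a (v (k - 1)) = B (v k)"
    by (simp only: B_v a_def)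
  also have "\<dots> = dsum (\<lambda>c. qint q (k + 1) * icoeff 3 l c +
      a * (if c = 0 then 0 else icoeff 3 (Suc l) (c - 1))) (k + 1)"
    using assms(1) B_dsum_same_parity[OF k(1,2), of "icoeff 1 (Suc l)"]
    unfolding icoeff_even_recurrence by (simp add: a_def k_def)
  also have "\<dots> = scale (qint q (k + 1)) (dsum (icoeff 3 l) (k + 1)) + scale a (dsum (icoeff 3 (Suc l)) (k - 1))"
    using dsum_shift[of "k + 1" "icoeff 3 (Suc l)"] k(1) unfolding k(5)
    by (simp add: dsum_scale dsum_add)
  also have "dsum (icoeff 3 (Suc l)) (k - 1) = v (k - 1)"
    using assms(2) unfolding k(4) by simp
  finally have *: "scale (qint q (k + 1)) (v (k + 1)) = scale (qint q (k + 1)) (dsum (icoeff 3 l) (k + 1))"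
    by simp
  \<comment> \<open>[k + 1] is cancelled only at positive index. At negative index both sides are 0,
    and at index 0 both are \<open>\<eta>\<close> because the leading coefficient is 1.\<close>
  consider "k + 1 < 0" | "k + 1 = 0" | "k + 1 > 0"
    by linarith
  then have "v (k + 1) = dsum (icoeff 3 l) (k + 1)"
  proof cases
    case 3
    with * show ?thesis
      using qint_nonzero scale_left_imp_eq by blast
  qed (simp_all add: v_neg dsum_neg v_0 dsum_0)
  then show ?thesis
    unfolding k(3) .
qed

text \<open>With k = n - 2l, the formula for \<open>B (v (k - 1))\<close> is solved for
  \<open>v k\<close>.\<close>

lemma v_even_step:
  assumes "v (int n - 1 - 2 * int l) = dsum (icoeff 3 l) (int n - 1 - 2 * int l)"
    and "v (int n - 2 * int (Suc l)) = dsum (icoeff 1 (Suc l)) (int n - 2 * int (Suc l))"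
  shows "v (int n - 2 * int l) = dsum (icoeff 1 l) (int n - 2 * int l)"
proof -
  define k where "k = int n - 2 * int l"
  define a where "a = q powi (k - 2 * int l - 3) * qint q (2 * int l + 2)"
  have k: "k \<le> int n" "odd (k - 1 - int n)" "int n - 1 - 2 * int l = k - 1"
    "int n - 2 * int (Suc l) = k - 2"
    by (auto simp: k_def)
  have "2 * (k - 1) - int n - 1 = k - 2 * int l - 3" "int n - (k - 1) + 1 = 2 * int l + 2" "k - 1 - 1 = k - 2"
    by (simp_all add: k_def)
  then have "scale (qint q k) (v k) + scale a (v (k - 2)) = B (v (k - 1))"
    by (simp only: B_v a_def diff_add_cancel)
  also have "\<dots> = dsum (\<lambda>c. qint q k * icoeff 1 l c +
      a * (if c = 0 then 0 else icoeff 1 (Suc l) (c - 1))) k"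
    using assms(1) B_dsum_other_parity[OF k(2), of "icoeff 3 l"]
    unfolding k(3) by (simp add: a_def icoeff_odd_recurrence)
  also have "\<dots> = scale (qint q k) (dsum (icoeff 1 l) k) + scale a (dsum (icoeff 1 (Suc l)) (k - 2))"
    using dsum_shift[OF k(1), of "icoeff 1 (Suc l)"] by (simp add: dsum_scale dsum_add)
  also have "dsum (icoeff 1 (Suc l)) (k - 2) = v (k - 2)"
    using assms(2) unfolding k(4) by simp
  finally have *: "scale (qint q k) (v k) = scale (qint q k) (dsum (icoeff 1 l) k)"
    by simp
  consider "k < 0" | "k = 0" | "k > 0"
    by linarith
  then have "v k = dsum (icoeff 1 l) k"
  proof cases
    case 3
    with * show ?thesis
      using qint_nonzero scale_left_imp_eq by blast
  qed (simp_all add: v_neg dsum_neg v_0 dsum_0)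
  then show ?thesis
    unfolding k_def .
qed

text \<open>The pair at l + 1 yields the second identity at l, which then yields the first one at l.
  The recursion starts at l \<ge> n, where no index is positive.\<close>

lemma v_eq_dsum:
  "v (int n - 2 * int l) = dsum (icoeff 1 l) (int n - 2 * int l) \<and>
   v (int n - 1 - 2 * int l) = dsum (icoeff 3 l) (int n - 1 - 2 * int l)"
proof (induction "n - l" arbitrary: l rule: less_induct)
  case less
  show ?case
  proof (cases "l < n")
    case True
    with less[of "Suc l"] show ?thesis
      using v_odd_step v_even_step by auto
  next
    case False
    then consider "int n - 2 * int l = 0" | "int n - 2 * int l < 0"
      by linarith
    then show ?thesis
      by cases (simp_all add: v_neg dsum_neg v_0 dsum_0)
  qed
qed

lemma dsum_eq_sum:
  assumes "k \<le> int n"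
  shows "dsum f k = (\<Sum>c | 2 * int c \<le> k. scale (f c) (B_idiv scale q B n (nat (k - 2 * int c)) \<eta>))"
proof -
  have "dsum f k = (\<Sum>c | 2 * int c \<le> k. scale (f c) (d (k - 2 * int c)))"
    unfolding dsum_def using assms by (intro sum.mono_neutral_right) (auto simp: d_def)
  then show ?thesis
    by (simp add: d_def)
qed

end

section \<open>The image of the variable is not a root of unity\<close>

context ground_field
begin

lemma iota_0: "\<iota> 0 = 0"
proof -
  have "\<iota> 0 + \<iota> 0 = \<iota> 0 + 0"
    by (simp flip: iota_add)
  then show ?thesis
    by (rule add_left_imp_eq)
qed

text \<open>Injectivity of a unital ring homomorphism on a field: for x \<noteq> 1 the element x - 1
  is invertible, so its image cannot be 0.\<close>

lemma iota_eq_1_iff: "\<iota> x = 1 \<longleftrightarrow> x = 1"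
proof
  assume *: "\<iota> x = 1"
  show "x = 1"
  proof (rule ccontr)
    assume "x \<noteq> 1"
    then have "\<iota> ((x - 1) * inverse (x - 1)) = 1"
      by (simp add: iota_one)
    moreover have "\<iota> (x - 1) + \<iota> 1 = \<iota> x"
      by (simp flip: iota_add)
    ultimately show False
      using iota_0 by (simp add: * iota_mult iota_one)
  qed
qed (simp add: iota_one)

lemma iota_power: "\<iota> (x ^ m) = \<iota> x ^ m"
  by (induction m) (simp_all add: iota_one iota_mult)

end

lemma q_var_power: "q_var ^ m = Fract (monom 1 m) 1"
  by (induction m) (simp_all add: q_var_def One_fract_def monom_Suc)

lemma (in ground_field) generic_parameter_iota_q_var: "generic_parameter (\<iota> q_var)"
proof
  have "q_var * inverse q_var = 1"
    by (simp add: q_var_def eq_fract One_fract_def)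
  then have "\<iota> q_var * \<iota> (inverse q_var) = 1"
    by (metis iota_mult iota_one)
  then show "\<iota> q_var \<noteq> 0"
    by auto
next
  fix m :: nat
  assume "m > 0"
  then have "q_var ^ m \<noteq> 1"
    \<comment> \<open>The power is a monomial of degree m > 0, whereas 1 has degree 0.\<close>
    by (simp add: q_var_power One_fract_def eq_fract) (metis degree_1 degree_monom_eq less_irrefl one_neq_zero)
  then show "\<iota> q_var ^ m \<noteq> 1"
    by (simp add: iota_eq_1_iff flip: iota_power)
qed

theorem proposition3p8:
  fixes \<iota> :: "rat poly fract \<Rightarrow> 'k::field"
    and scale :: "'k \<Rightarrow> 'v::ab_group_add \<Rightarrow> 'v"
    and q :: 'k
    and E F K K' B :: "'v \<Rightarrow> 'v"
    and n l :: nat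
    and \<eta> :: 'v
  assumes "ground_field \<iota>"
    and "q = \<iota> q_var"
    and "simple_highest_weight_module scale q E F K K' n \<eta>"
    and "B = B_op scale q E F K'"
  shows
    "F_div scale q F (int n - 2 * int l) \<eta> =
       (\<Sum>c | int c \<le> int n div 2 - int l.
          scale ((-1) ^ c * q powi (- ((2 * int l + 1) * int c)) * qbinom (q ^ 2) (int l + int c) c)
            (B_idiv scale q B n (nat (int n - 2 * int l - 2 * int c)) \<eta>))
     \<and>
     F_div scale q F (int n - 1 - 2 * int l) \<eta> =
       (\<Sum>c | int c \<le> (int n - 1) div 2 - int l.
          scale ((-1) ^ c * q powi (- ((2 * int l + 3) * int c)) * qbinom (q ^ 2) (int l + int c) c)
            (B_idiv scale q B n (nat (int n - 1 - 2 * int l - 2 * int c)) \<eta>))"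
proof -
  interpret M: simple_highest_weight_module scale q E F K K' n \<eta>
    by fact
  interpret generic_parameter q
    unfolding assms(2) using assms(1) by (rule ground_field.generic_parameter_iota_q_var)
  interpret highest_weight_vector scale q E F K K' n \<eta>
    by unfold_locales (fact M.K_eta M.E_eta)+
  \<comment> \<open>Integer \<open>div\<close> rounds down, so for n = 0 the second bound is
    negative and that sum is empty.\<close>
  have "int c \<le> int n div 2 - int l \<longleftrightarrow> 2 * int c \<le> int n - 2 * int l"
    "int c \<le> (int n - 1) div 2 - int l \<longleftrightarrow> 2 * int c \<le> int n - 1 - 2 * int l" for c
    by linarith+
  then show ?thesis
    using v_eq_dsum[of l] unfolding assms(4) by (simp add: dsum_eq_sum icoeff_def)
qed

end
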